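(* Let $(J_n)_{n\ge 0}$ be the Jacobsthal numbers and, for $n\ge 0$, let $$HSJ_n=\begin{bmatrix} J_n+jJ_{n+3}\\ -J_{n+1}+jJ_{n+2}\end{bmatrix}.$$ Then for all $n\ge 1$: (1) $\displaystyle\sum_{i=1}^{n} HSJ_{2i}=\frac23 HSJ_{2n+1}+\frac13\left(HSJ_2-(2n+1)HSJ_3+n\,HSJ_4\right)$; (2) $\displaystyle\sum_{i=1}^{n} HSJ_{2i-1}=\frac23 HSJ_{2n}-\frac13\left(n\,HSJ_4-2n\,HSJ_3+2\,HSJ_0\right)$.
   Context: The Jacobsthal numbers are defined by $J_0=0$, $J_1=1$, $J_{n+2}=J_{n+1}+2J_n$. Here $j$ is the hyperbolic unit ($j^2=1$, $j\neq\pm1$); spinors are column vectors with two hyperbolic-number entries, added and multiplied by real scalars componentwise. *)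

theory Defs
  imports "HOL-Analysis.Analysis"
begin

fun jacobsthal :: "nat \<Rightarrow> nat" where
  "jacobsthal 0 = 0"
| "jacobsthal (Suc 0) = 1"
| "jacobsthal (Suc (Suc n)) = jacobsthal (Suc n) + 2 * jacobsthal n"

text \<open>
  \<open>Hyperbolic x y\<close> stands for the hyperbolic number \<open>x + j y\<close> with \<open>x, y\<close> real and \<open>j\<^sup>2 = 1\<close>.
\<close>

datatype hyperbolic = Hyperbolic (hRe: real) (hIm: real)

lemma hyperbolic_eq_iff: "z = w \<longleftrightarrow> hRe z = hRe w \<and> hIm z = hIm w"
  by (auto intro: hyperbolic.expand)

instantiation hyperbolic :: "{comm_ring_1, real_algebra_1}"
begin

definition zero_hyperbolic :: hyperbolic where
  "0 = Hyperbolic 0 0"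

definition one_hyperbolic :: hyperbolic where
  "1 = Hyperbolic 1 0"

definition plus_hyperbolic :: "hyperbolic \<Rightarrow> hyperbolic \<Rightarrow> hyperbolic" where
  "z + w = Hyperbolic (hRe z + hRe w) (hIm z + hIm w)"

definition uminus_hyperbolic :: "hyperbolic \<Rightarrow> hyperbolic" where
  "- z = Hyperbolic (- hRe z) (- hIm z)"

definition minus_hyperbolic :: "hyperbolic \<Rightarrow> hyperbolic \<Rightarrow> hyperbolic" where
  "z - w = Hyperbolic (hRe z - hRe w) (hIm z - hIm w)"

definition times_hyperbolic :: "hyperbolic \<Rightarrow> hyperbolic \<Rightarrow> hyperbolic" where
  "z * w = Hyperbolic (hRe z * hRe w + hIm z * hIm w) (hRe z * hIm w + hIm z * hRe w)"

definition scaleR_hyperbolic :: "real \<Rightarrow> hyperbolic \<Rightarrow> hyperbolic" where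
  "r *\<^sub>R z = Hyperbolic (r * hRe z) (r * hIm z)"

instance
  by standard
    (simp_all add: hyperbolic_eq_iff zero_hyperbolic_def one_hyperbolic_def plus_hyperbolic_def
      uminus_hyperbolic_def minus_hyperbolic_def times_hyperbolic_def scaleR_hyperbolic_def
      algebra_simps)

end

definition hyp_j :: hyperbolic where
  "hyp_j = Hyperbolic 0 1"

lemma hyp_j_square: "hyp_j\<^sup>2 = 1"
  by (simp add: hyp_j_def power2_eq_square times_hyperbolic_def one_hyperbolic_def)

lemma hyp_j_neq: "hyp_j \<noteq> 1" "hyp_j \<noteq> - 1"
  by (simp_all add: hyp_j_def one_hyperbolic_def uminus_hyperbolic_def)

lemma Hyperbolic_eq: "Hyperbolic x y = of_real x + hyp_j * of_real y"
  by (simp add: of_real_def hyp_j_def plus_hyperbolic_def times_hyperbolic_def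
      scaleR_hyperbolic_def one_hyperbolic_def)

type_synonym hyperbolic_spinor = "hyperbolic ^ 2"

definition HSJ :: "nat \<Rightarrow> hyperbolic_spinor" where
  "HSJ n = vector [of_nat (jacobsthal n) + hyp_j * of_nat (jacobsthal (n + 3)),
                   - of_nat (jacobsthal (n + 1)) + hyp_j * of_nat (jacobsthal (n + 2))]"

end

theory Submission
  imports Defs
begin

text \<open>
  The spinors inherit the recurrence \<open>a (n + 2) = a (n + 1) + 2 a n\<close>, so \<open>a (n + 1) - 2 a n\<close> merely
  changes sign from one index to the next; both sums then follow by induction, their correction
  terms being multiples of this quantity, taken as \<open>a 4 - 2 a 3\<close>.
\<close>

lemma HSJ_rec: "HSJ (n + 2) = HSJ (n + 1) + 2 *\<^sub>R HSJ n"
proof -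
  \<comment> \<open>The entries of \<open>HSJ\<close> sample the sequence at offsets 0 to 3 and the
    recurrence is linear, so each entry inherits it from the matching \<open>k\<close>. Offset 0
    needs its own simplified instance, since \<open>n + 2\<close> does not match
    \<open>n + 2 + k\<close>.\<close>
  have rec: "jacobsthal (n + 2 + k) = jacobsthal (n + 1 + k) + 2 * jacobsthal (n + k)" for k
    by simp
  show ?thesis
    unfolding HSJ_def vec_eq_iff forall_2 vector_add_component vector_scaleR_component vector_2
      rec rec[of 0, unfolded add_0_right] of_nat_add of_nat_mult
    by (simp add: scaleR_2 distrib_left del: jacobsthal.simps)
qed

text \<open>The characteristic roots are 2 and -1; subtracting twice the previous term removes the
  \<open>2 ^ n\<close> part and leaves only the alternating one.\<close>

lemma jacobsthal_recurrence_alternating: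
  fixes a :: "nat \<Rightarrow> 'a::real_vector"
  assumes rec: "\<And>n. a (n + 2) = a (n + 1) + 2 *\<^sub>R a n"
  shows "a (n + 1) - 2 *\<^sub>R a n = (-1) ^ n *\<^sub>R (a 1 - 2 *\<^sub>R a 0)"
proof (induction n)
  case (Suc n)
  have "a (Suc n + 1) - 2 *\<^sub>R a (Suc n) = - (a (n + 1) - 2 *\<^sub>R a n)"
    using rec[of n] by (simp add: scaleR_2)
  then show ?case
    unfolding Suc.IH by simp
qed simp

lemma jacobsthal_recurrence_step:
  fixes a :: "nat \<Rightarrow> 'a::real_vector"
  assumes rec: "\<And>n. a (n + 2) = a (n + 1) + 2 *\<^sub>R a n"
  shows "a (2 * n + 2) = 2 *\<^sub>R a (2 * n + 1) + (a 4 - 2 *\<^sub>R a 3)"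
    and "a (2 * n + 1) = 2 *\<^sub>R a (2 * n) - (a 4 - 2 *\<^sub>R a 3)"
proof -
  \<comment> \<open>The index 3 is odd, so this difference agrees with those at the odd indices
    \<open>2 * n + 1\<close> and is opposite to those at the even indices
    \<open>2 * n\<close>.\<close>
  have d: "a 4 - 2 *\<^sub>R a 3 = - (a 1 - 2 *\<^sub>R a 0)"
    using jacobsthal_recurrence_alternating[of a 3, OF rec] by simp
  have "a (2 * n + 2) - 2 *\<^sub>R a (2 * n + 1) = - (a 1 - 2 *\<^sub>R a 0)"
    using jacobsthal_recurrence_alternating[of a "2 * n + 1", OF rec] by simp
  then show "a (2 * n + 2) = 2 *\<^sub>R a (2 * n + 1) + (a 4 - 2 *\<^sub>R a 3)"
    unfolding d by (metis add.commute diff_add_cancel)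
  have "a (2 * n + 1) - 2 *\<^sub>R a (2 * n) = a 1 - 2 *\<^sub>R a 0"
    using jacobsthal_recurrence_alternating[of a "2 * n", OF rec] by simp
  then show "a (2 * n + 1) = 2 *\<^sub>R a (2 * n) - (a 4 - 2 *\<^sub>R a 3)"
    unfolding d by (metis add.commute diff_add_cancel diff_minus_eq_add)
qed

text \<open>Three times each summand is a telescoping difference of
  \<open>2 *\<^sub>R a (2 * n + 1)\<close> plus the constant \<open>d\<close>, which accumulates to
  \<open>real n *\<^sub>R d\<close>.\<close>

lemma jacobsthal_recurrence_sum_even:
  fixes a :: "nat \<Rightarrow> 'a::real_vector"
  assumes rec: "\<And>n. a (n + 2) = a (n + 1) + 2 *\<^sub>R a n"
  shows "(\<Sum>i=1..n. a (2 * i)) =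
    (2/3) *\<^sub>R a (2 * n + 1) + (1/3) *\<^sub>R (a 2 - (2 * real n + 1) *\<^sub>R a 3 + real n *\<^sub>R a 4)"
proof -
  define d where "d = a 4 - 2 *\<^sub>R a 3"
  \<comment> \<open>Tripling keeps fractions out of the induction; \<open>2 *\<^sub>R a 1\<close> is
    the lower end of the telescoping sum.\<close>
  have triple: "3 *\<^sub>R (\<Sum>i=1..n. a (2 * i)) = 2 *\<^sub>R a (2 * n + 1) - 2 *\<^sub>R a 1 + real n *\<^sub>R d"
  proof (induction n)
    case (Suc n)
    have even: "a (2 * n + 2) = 2 *\<^sub>R a (2 * n + 1) + d"
      using jacobsthal_recurrence_step(1)[of a, OF rec] by (simp only: d_def)
    have odd: "a (2 * Suc n + 1) = a (2 * n + 2) + 2 *\<^sub>R a (2 * n + 1)"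
      using rec[of "2 * n + 1"] by (simp add: numeral_3_eq_3)
    have "3 *\<^sub>R a (2 * n + 2) = 2 *\<^sub>R a (2 * n + 2) + a (2 * n + 2)"
      using scaleR_left_distrib[of 2 1 "a (2 * n + 2)"] by simp
    also have "\<dots> = 2 *\<^sub>R a (2 * Suc n + 1) - 2 *\<^sub>R a (2 * n + 1) + d"
      \<comment> \<open>Both sides reduce to six copies of \<open>a (2 * n + 1)\<close> and three of
        \<open>d\<close>.\<close>
      unfolding odd even by (simp add: scaleR_2)
    finally have "3 *\<^sub>R a (2 * n + 2) = 2 *\<^sub>R a (2 * Suc n + 1) - 2 *\<^sub>R a (2 * n + 1) + d" .
    moreover have "(\<Sum>i=1..Suc n. a (2 * i)) = (\<Sum>i=1..n. a (2 * i)) + a (2 * n + 2)"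
      by simp
    ultimately show ?case
      using Suc.IH by (simp add: scaleR_right_distrib scaleR_left_distrib)
  qed simp
  \<comment> \<open>The lower end \<open>a 1\<close> is traded for \<open>a 2 - a 3\<close>, which
    supplies the extra 1 in the coefficient \<open>2 * real n + 1\<close>.\<close>
  have "a 3 = a 2 + 2 *\<^sub>R a 1"
    using rec[of 1] by (simp add: numeral_3_eq_3 numeral_2_eq_2)
  then have corr: "a 2 - (2 * real n + 1) *\<^sub>R a 3 + real n *\<^sub>R a 4 = real n *\<^sub>R d - 2 *\<^sub>R a 1"
    by (simp add: d_def algebra_simps)
  show ?thesis
    unfolding corr using arg_cong[OF triple, of "scaleR (1/3)"] by (simp add: algebra_simps)
qed

text \<open>The same telescoping, now along even indices: \<open>d\<close> enters with the opposite
  sign, and the lower end \<open>a 0\<close> already appears in the closed form.\<close>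

lemma jacobsthal_recurrence_sum_odd:
  fixes a :: "nat \<Rightarrow> 'a::real_vector"
  assumes rec: "\<And>n. a (n + 2) = a (n + 1) + 2 *\<^sub>R a n"
  shows "(\<Sum>i=1..n. a (2 * i - 1)) =
    (2/3) *\<^sub>R a (2 * n) - (1/3) *\<^sub>R (real n *\<^sub>R a 4 - (2 * real n) *\<^sub>R a 3 + 2 *\<^sub>R a 0)"
proof -
  define d where "d = a 4 - 2 *\<^sub>R a 3"
  have triple: "3 *\<^sub>R (\<Sum>i=1..n. a (2 * i - 1)) = 2 *\<^sub>R a (2 * n) - 2 *\<^sub>R a 0 - real n *\<^sub>R d"
  proof (induction n)
    case (Suc n)
    have odd: "a (2 * n + 1) = 2 *\<^sub>R a (2 * n) - d"
      using jacobsthal_recurrence_step(2)[of a, OF rec] by (simp only: d_def)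
    have even: "a (2 * Suc n) = a (2 * n + 1) + 2 *\<^sub>R a (2 * n)"
      using rec[of "2 * n"] by simp
    have "3 *\<^sub>R a (2 * n + 1) = 2 *\<^sub>R a (2 * n + 1) + a (2 * n + 1)"
      using scaleR_left_distrib[of 2 1 "a (2 * n + 1)"] by simp
    also have "\<dots> = 2 *\<^sub>R a (2 * Suc n) - 2 *\<^sub>R a (2 * n) - d"
      unfolding even odd by (simp add: scaleR_2)
    finally have "3 *\<^sub>R a (2 * n + 1) = 2 *\<^sub>R a (2 * Suc n) - 2 *\<^sub>R a (2 * n) - d" .
    moreover have "(\<Sum>i=1..Suc n. a (2 * i - 1)) = (\<Sum>i=1..n. a (2 * i - 1)) + a (2 * n + 1)"
      by simp
    ultimately show ?case
      using Suc.IH by (simp add: scaleR_right_distrib scaleR_left_distrib)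
  qed simp
  have corr: "real n *\<^sub>R a 4 - (2 * real n) *\<^sub>R a 3 = real n *\<^sub>R d"
    by (simp add: d_def algebra_simps)
  show ?thesis
    unfolding corr using arg_cong[OF triple, of "scaleR (1/3)"] by (simp add: algebra_simps)
qed

theorem theorem3p7:
  fixes n :: nat
  assumes "n \<ge> 1"
  shows "(\<Sum>i=1..n. HSJ (2 * i)) =
           (2/3) *\<^sub>R HSJ (2 * n + 1)
           + (1/3) *\<^sub>R (HSJ 2 - (2 * real n + 1) *\<^sub>R HSJ 3 + real n *\<^sub>R HSJ 4)
       \<and> (\<Sum>i=1..n. HSJ (2 * i - 1)) =
           (2/3) *\<^sub>R HSJ (2 * n)
           - (1/3) *\<^sub>R (real n *\<^sub>R HSJ 4 - (2 * real n) *\<^sub>R HSJ 3 + 2 *\<^sub>R HSJ 0)"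
  using jacobsthal_recurrence_sum_even[of HSJ, OF HSJ_rec]
    jacobsthal_recurrence_sum_odd[of HSJ, OF HSJ_rec] by blast

end
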